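(* Let $G$ be a $2$-connected geodetic graph with minimum degree $\delta(G)\ge 3$. Then $G$ is $3$-connected. This lower bound on the connectivity is tight, as shown by the Petersen graph: the Petersen graph is a $2$-connected geodetic graph with minimum degree at least $3$ that is not $4$-connected.
   Context: Graphs are undirected and simple. A graph $G$ is geodetic if between any two of its vertices there exists a unique shortest path, where a path is regarded as a sequence of vertices. $\delta(G)$ denotes the minimum degree of $G$. A graph is $k$-connected if it has more than $k$ vertices and remains connected after the removal of any set of fewer than $k$ vertices. *)

theory Defs
  imports Main "HOL-Library.Extended_Nat"
begin

text \<open>
  Finiteness is not part of the definition of a graph below. Cardinalities are therefore
  taken in \<^typ>\<open>enat\<close>, because \<^const>\<open>card\<close> is 0 on infinite sets.
\<close>

record 'a ugraph =
  verts :: "'a set"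
  edges :: "'a set set"

definition simple_graph :: "'a ugraph \<Rightarrow> bool" where
  "simple_graph G \<longleftrightarrow> (\<forall>e\<in>edges G. e \<subseteq> verts G \<and> card e = 2)"

definition ecard :: "'a set \<Rightarrow> enat" where
  "ecard A = (if finite A then enat (card A) else \<infinity>)"

definition adjacent :: "'a ugraph \<Rightarrow> 'a \<Rightarrow> 'a \<Rightarrow> bool" where
  "adjacent G u v \<longleftrightarrow> {u, v} \<in> edges G"

definition degree :: "'a ugraph \<Rightarrow> 'a \<Rightarrow> enat" where
  "degree G v = ecard {u \<in> verts G. adjacent G v u}"

definition min_degree :: "'a ugraph \<Rightarrow> enat" where
  "min_degree G = (INF v\<in>verts G. degree G v)"

definition path_between :: "'a ugraph \<Rightarrow> 'a \<Rightarrow> 'a list \<Rightarrow> 'a \<Rightarrow> bool" where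
  "path_between G u p v \<longleftrightarrow>
     p \<noteq> [] \<and> hd p = u \<and> last p = v \<and> set p \<subseteq> verts G \<and> distinct p \<and> successively (adjacent G) p"

text \<open>
  Lengths of paths from \<open>u\<close> to \<open>v\<close> are compared through the number of vertices, which is
  one more than the number of edges.
\<close>

definition shortest_path :: "'a ugraph \<Rightarrow> 'a \<Rightarrow> 'a list \<Rightarrow> 'a \<Rightarrow> bool" where
  "shortest_path G u p v \<longleftrightarrow>
     path_between G u p v \<and> (\<forall>q. path_between G u q v \<longrightarrow> length p \<le> length q)"

definition geodetic :: "'a ugraph \<Rightarrow> bool" where
  "geodetic G \<longleftrightarrow> (\<forall>u\<in>verts G. \<forall>v\<in>verts G. \<exists>!p. shortest_path G u p v)"

definition connected_graph :: "'a ugraph \<Rightarrow> bool" where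
  "connected_graph G \<longleftrightarrow> (\<forall>u\<in>verts G. \<forall>v\<in>verts G. \<exists>p. path_between G u p v)"

definition remove_verts :: "'a ugraph \<Rightarrow> 'a set \<Rightarrow> 'a ugraph" where
  "remove_verts G S = \<lparr>verts = verts G - S, edges = {e \<in> edges G. e \<inter> S = {}}\<rparr>"

definition k_connected :: "nat \<Rightarrow> 'a ugraph \<Rightarrow> bool" where
  "k_connected k G \<longleftrightarrow>
     ecard (verts G) > enat k \<and>
     (\<forall>S. S \<subseteq> verts G \<and> ecard S < enat k \<longrightarrow> connected_graph (remove_verts G S))"

text \<open>The Petersen graph as the Kneser graph of the 2-subsets of a 5-element set.\<close>

definition petersen :: "nat set ugraph" where
  "petersen =
     (let V = {A. A \<subseteq> {0..<5} \<and> card A = 2}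
      in \<lparr>verts = V, edges = {{A, B} | A B. A \<in> V \<and> B \<in> V \<and> A \<inter> B = {}}\<rparr>)"

end

theory Submission
  imports Defs
begin

text \<open>
  Suppose that removing two vertices \<open>x\<close> and \<open>y\<close> splits a 2-connected geodetic graph into two
  nonempty sides \<open>A\<close> and \<open>B\<close> without edges between them. The proof exhibits a vertex of degree at
  most 2. It works with distances instead of paths: geodeticity says exactly that from \<open>u \<noteq> v\<close>
  there is only one neighbour of \<open>u\<close> that is closer to \<open>v\<close> (\<open>towards\<close>, \<open>towards_unique\<close>).

  Let \<open>D\<close> be the distance between \<open>x\<close> and \<open>y\<close>, and let the skew of \<open>v\<close> be its distance to \<open>x\<close>
  minus its distance to \<open>y\<close>. The skew runs from \<open>- D\<close> at \<open>x\<close> to \<open>D\<close> at \<open>y\<close> and changes by at most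
  2 along an edge. If \<open>a \<in> A\<close> and \<open>b \<in> B\<close> have opposite skews, then the routes from \<open>a\<close> to \<open>b\<close>
  through \<open>x\<close> and through \<open>y\<close> are equally long. By uniqueness they are the same geodesic, which
  therefore contains both \<open>x\<close> and \<open>y\<close>, and the skews are \<open>\<plusminus> D\<close> (\<open>opposite_values\<close>). So, apart
  from \<open>\<plusminus> D\<close>, the skews on the two sides avoid each other up to sign.

  Let \<open>B\<close> be the side that contains the first step \<open>p\<close> of the geodesic from \<open>x\<close> to \<open>y\<close> (there is
  one, since \<open>x\<close> and \<open>y\<close> turn out not to be adjacent). The skews of the geodesic are
  \<open>- D, - D + 2, \<dots>, D\<close>, so \<open>A\<close> avoids \<open>D - 2\<close> and, unless \<open>D = 2\<close>, also \<open>D - 4\<close>. A discrete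
  intermediate value argument (\<open>value_attained\<close>) makes \<open>A\<close> attain the values \<open>D - 1\<close> and \<open>D - 3\<close>,
  and hence makes \<open>B\<close> avoid the two values next to the skew \<open>2 - D\<close> of \<open>p\<close>. Edges of \<open>B\<close> at the
  level \<open>2 - D\<close> thus stay in the level or change the skew by exactly 2, and an edge of the second
  kind is the unique step towards \<open>x\<close> or towards \<open>y\<close>. It follows that every other vertex of this
  level has all its neighbours in the level. Then \<open>p\<close> would be a cut vertex if there were such a
  vertex; so \<open>p\<close> is alone in its level and its only neighbours are the next vertices towards \<open>x\<close>
  and towards \<open>y\<close> (\<open>geodesic_neighbour_degree\<close>).

  For the Petersen graph, everything follows from two properties: adjacent vertices have no common
  neighbour, and distinct nonadjacent vertices have exactly one. The three neighbours of a vertex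
  separate it from the rest.
\<close>

section \<open>Paths\<close>

lemma adjacent_commute: "adjacent G u v \<longleftrightarrow> adjacent G v u"
  by (simp add: adjacent_def insert_commute)

lemma simple_graph_adjacentD:
  assumes "simple_graph G" "adjacent G u v"
  shows "u \<in> verts G" "v \<in> verts G" "u \<noteq> v"
  using assms by (fastforce simp: simple_graph_def adjacent_def)+

lemma path_between_rev:
  assumes "path_between G u p v"
  shows "path_between G v (rev p) u"
  using assms adjacent_commute[of G]
  by (auto simp: path_between_def hd_rev last_rev successively_rev)

lemma path_between_Cons:
  assumes "path_between G w q v" "u \<in> verts G" "adjacent G u w" "u \<notin> set q"
  shows "path_between G u (u # q) v"
  using assms by (cases q) (auto simp: path_between_def)

lemma path_between_suffix:
  assumes "path_between G w (r @ u # t) v"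
  shows "path_between G u (u # t) v"
  using assms by (auto simp: path_between_def successively_append_iff)

text \<open>
  The vertex \<open>u\<close> may already lie on the path; then the part of the path from \<open>u\<close> on does the job,
  so that distances can be compared without introducing walks.
\<close>

lemma path_between_extend:
  assumes "path_between G w q v" "u \<in> verts G" "adjacent G u w"
  obtains q' where "path_between G u q' v" "length q' \<le> Suc (length q)"
proof (cases "u \<in> set q")
  case True
  then obtain r t where "q = r @ u # t" by (meson split_list)
  with assms that show ?thesis using path_between_suffix[of G w r u t v] by fastforce
next
  case False
  with assms that show ?thesis using path_between_Cons by fastforce
qed

lemma unique_shortest_pathI:
  assumes "path_between G u p v"
    and "\<And>q. path_between G u q v \<Longrightarrow> q \<noteq> p \<Longrightarrow> length p < length q"
  shows "\<exists>!p. shortest_path G u p v"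
  using assms unfolding shortest_path_def by (metis leD le_less_linear less_imp_le order_refl)

lemma connected_graph_crossing_edge:
  assumes "connected_graph H" "C \<subseteq> verts H" "C \<noteq> {}" "C \<noteq> verts H"
  shows "\<exists>u\<in>C. \<exists>v\<in>verts H - C. adjacent H u v"
proof (rule ccontr)
  assume no: "\<not> ?thesis"
  have stay: "set p \<subseteq> C" if "successively (adjacent H) p" "p \<noteq> []" "hd p \<in> C" "set p \<subseteq> verts H" for p
    using that
  proof (induction p rule: induct_list012)
    case (3 a b p)
    then show ?case using no by auto
  qed auto
  obtain c e where ce: "c \<in> C" "e \<in> verts H" "e \<notin> C" using assms by auto
  then obtain p where "path_between H c p e"
    using assms unfolding connected_graph_def by blast
  then have "set p \<subseteq> C" "e \<in> set p"
    using stay[of p] ce(1) last_in_set[of p] by (simp_all add: path_between_def)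
  with ce(3) show False by blast
qed

lemma connected_remove_vertex:
  assumes "k_connected 2 G" "z \<in> verts G"
  shows "connected_graph (remove_verts G {z})"
  using assms unfolding k_connected_def by (simp add: ecard_def)

text \<open>
  The only form in which 2-connectedness enters the cut argument: a set of vertices other than
  \<open>z\<close> can be left along an edge that avoids \<open>z\<close>.
\<close>

lemma no_cut_vertex:
  assumes "k_connected 2 G" "z \<in> verts G" "C \<subseteq> verts G - {z}" "C \<noteq> {}" "C \<noteq> verts G - {z}"
  shows "\<exists>u\<in>C. \<exists>v\<in>verts G - {z} - C. adjacent G u v"
proof -
  let ?H = "remove_verts G {z}"
  have "\<exists>u\<in>C. \<exists>v\<in>verts ?H - C. adjacent ?H u v"
  proof (rule connected_graph_crossing_edge)
    show "connected_graph ?H" by (rule connected_remove_vertex[OF assms(1,2)])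
  qed (use assms in \<open>simp_all add: remove_verts_def\<close>)
  then show ?thesis by (auto simp: remove_verts_def adjacent_def)
qed


section \<open>Distances in geodetic graphs\<close>

definition dist :: "'a ugraph \<Rightarrow> 'a \<Rightarrow> 'a \<Rightarrow> nat" where
  "dist G u v = (LEAST n. \<exists>p. path_between G u p v \<and> length p = Suc n)"

locale geodetic_graph =
  fixes G :: "'a ugraph"
  assumes simple: "simple_graph G" and geodetic: "geodetic G"
begin

abbreviation V where "V \<equiv> verts G"
abbreviation adj where "adj \<equiv> adjacent G"
abbreviation d where "d \<equiv> dist G"

lemmas adjD = simple_graph_adjacentD[OF simple]

lemma dist_path:
  assumes "u \<in> V" "v \<in> V"
  obtains p where "path_between G u p v" "length p = Suc (d u v)"
proof -
  obtain p where p: "path_between G u p v"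
    using assms geodetic unfolding geodetic_def shortest_path_def by blast
  then have "length p = Suc (length p - 1)" by (cases p) (auto simp: path_between_def)
  with p have "\<exists>n p. path_between G u p v \<and> length p = Suc n" by blast
  from LeastI_ex[OF this] that show ?thesis unfolding dist_def by blast
qed

lemma dist_le: "path_between G u p v \<Longrightarrow> length p \<le> Suc n \<Longrightarrow> d u v \<le> n"
proof -
  assume p: "path_between G u p v" "length p \<le> Suc n"
  then have "length p = Suc (length p - 1)" by (cases p) (auto simp: path_between_def)
  with p(1) have "d u v \<le> length p - 1" unfolding dist_def by (intro Least_le) blast
  with p(2) show ?thesis by simp
qed

lemma dist_sym:
  assumes "u \<in> V" "v \<in> V"
  shows "d u v = d v u"
proof -
  have "d b a \<le> d a b" if "a \<in> V" "b \<in> V" for a b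
    using dist_path[OF that] path_between_rev[of G a _ b] dist_le[of b _ a] by (metis length_rev order_refl)
  with assms show ?thesis by (simp add: order_antisym)
qed

lemma dist_self [simp]: "u \<in> V \<Longrightarrow> d u u = 0"
  using dist_le[of u "[u]" u 0] by (simp add: path_between_def)

lemma dist_eq_0:
  assumes "u \<in> V" "v \<in> V" "d u v = 0"
  shows "u = v"
proof -
  obtain p where "path_between G u p v" "length p = Suc 0" using dist_path assms by metis
  then show ?thesis by (auto simp: path_between_def length_Suc_conv)
qed

lemma dist_edge:
  assumes "adj u w" "v \<in> V"
  shows "d u v \<le> Suc (d w v)"
proof -
  obtain p where "path_between G w p v" "length p = Suc (d w v)"
    using dist_path assms adjD by metis
  with assms show ?thesis using path_between_extend[of G w p v u] dist_le adjD
    by (metis Suc_le_mono)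
qed

lemma towards:
  assumes "u \<in> V" "v \<in> V" "u \<noteq> v"
  obtains w where "adj u w" "d u v = Suc (d w v)"
proof -
  obtain p where p: "path_between G u p v" "length p = Suc (d u v)" using dist_path assms by metis
  with assms obtain w q where pq: "p = u # w # q"
    by (cases p; cases "tl p") (auto simp: path_between_def)
  with p have uw: "adj u w" and q: "path_between G w (w # q) v" by (auto simp: path_between_def)
  from dist_le[OF q, of "d u v - 1"] p pq have "d w v \<le> d u v - 1" "d u v \<noteq> 0" by auto
  with dist_edge[OF uw assms(2)] uw that show ?thesis by simp
qed

text \<open>
  A geodesic from \<open>w\<close> to \<open>v\<close> cannot pass through \<open>u\<close>, which is farther from \<open>v\<close>; so \<open>u\<close> can be put
  in front of it. This turns two different steps from \<open>u\<close> towards \<open>v\<close> into two different geodesics.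
\<close>

lemma Cons_shortest_path:
  assumes "adj u w" "v \<in> V" "d u v = Suc (d w v)"
  obtains q where "shortest_path G u (u # w # q) v"
proof -
  obtain p where p: "path_between G w p v" "length p = Suc (d w v)"
    using dist_path assms adjD by metis
  have "u \<notin> set p"
  proof
    assume "u \<in> set p"
    then obtain r t where "p = r @ u # t" by (meson split_list)
    with p have "d u v \<le> d w v"
      using path_between_suffix[of G w r u t v] dist_le[of u "u # t" v "d w v"] by simp
    with assms show False by simp
  qed
  with p assms adjD have path: "path_between G u (u # p) v" using path_between_Cons by metis
  have "shortest_path G u (u # p) v"
    unfolding shortest_path_def
  proof (intro conjI allI impI path)
    fix q assume "path_between G u q v"
    then have "d u v \<le> length q - 1" "q \<noteq> []"
      using dist_le by (fastforce, simp add: path_between_def)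
    then show "length (u # p) \<le> length q" using p assms by (cases q) auto
  qed
  moreover obtain q where "p = w # q" using p by (cases p) (auto simp: path_between_def)
  ultimately show ?thesis using that by blast
qed

lemma towards_unique:
  assumes "adj u w" "adj u w'" "v \<in> V" "d u v = Suc (d w v)" "d u v = Suc (d w' v)"
  shows "w = w'"
proof -
  obtain q q' where "shortest_path G u (u # w # q) v" "shortest_path G u (u # w' # q') v"
    using Cons_shortest_path assms by metis
  then show ?thesis using geodetic adjD assms unfolding geodetic_def by blast
qed

lemma triangle:
  assumes "u \<in> V" "v \<in> V" "w \<in> V"
  shows "d u w \<le> d u v + d v w"
  using assms
proof (induction "d u v" arbitrary: u)
  case 0
  then show ?case using dist_eq_0 by force
next
  case (Suc n)
  then obtain u' where u': "adj u u'" "d u v = Suc (d u' v)" using towards by (metis dist_self nat.distinct(1))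
  with Suc have "d u' w \<le> d u' v + d v w" using adjD by auto
  with u' dist_edge[of u u' w] Suc show ?case by simp
qed

end


section \<open>Two-vertex cuts\<close>

locale separating_pair = geodetic_graph +
  fixes x y :: 'a and A B :: "'a set"
  assumes x: "x \<in> V" and y: "y \<in> V" and x_neq_y: "x \<noteq> y"
    and V_eq: "V = {x, y} \<union> A \<union> B"
    and disj: "x \<notin> A" "y \<notin> A" "x \<notin> B" "y \<notin> B" "A \<inter> B = {}"
    and nonempty: "A \<noteq> {}" "B \<noteq> {}"
    and separated: "a \<in> A \<Longrightarrow> b \<in> B \<Longrightarrow> \<not> adj a b"
    and two_connected: "k_connected 2 G"
begin

definition skew :: "'a \<Rightarrow> int" where
  "skew v = int (d v x) - int (d v y)"

abbreviation D :: int where "D \<equiv> int (d x y)"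

lemma skew_x: "skew x = - D" and skew_y: "skew y = D"
  using x y dist_sym[OF x y] by (auto simp: skew_def)

lemma D_pos: "D \<ge> 1"
  using dist_eq_0[OF x y] x_neq_y by (cases "d x y") auto

lemma A_V: "a \<in> A \<Longrightarrow> a \<in> V" and B_V: "b \<in> B \<Longrightarrow> b \<in> V"
  using V_eq by auto

lemma nbr_A: "a \<in> A \<Longrightarrow> adj a v \<Longrightarrow> v \<in> A \<or> v = x \<or> v = y"
  using separated[of a v] adjD[of a v] V_eq by auto

lemma nbr_B: "b \<in> B \<Longrightarrow> adj b v \<Longrightarrow> v \<in> B \<or> v = x \<or> v = y"
  using separated[of v b] adjD[of b v] adjacent_commute[of G b v] V_eq by auto

lemma dist_edge':
  assumes "adj u v" "w \<in> V"
  shows "int (d v w) \<le> int (d u w) + 1" "int (d u w) \<le> int (d v w) + 1"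
  using dist_edge[of u v w] dist_edge[of v u w] assms adjacent_commute[of G u v] by auto

lemma skew_edge: "adj u v \<Longrightarrow> skew v \<le> skew u + 2"
  using dist_edge'[of u v x] dist_edge'[of u v y] x y unfolding skew_def by linarith

text \<open>
  An edge that raises the skew by 2 is at the same time a step of \<open>v\<close> towards \<open>x\<close> and of \<open>u\<close>
  towards \<open>y\<close>.
\<close>

lemma skew_step2:
  assumes "adj u v" "skew v = skew u + 2"
  shows "d v x = Suc (d u x)" "d u y = Suc (d v y)"
  using dist_edge'[of u v x] dist_edge'[of u v y] x y assms unfolding skew_def by linarith+

text \<open>
  Skew \<open>- D\<close> means that the geodesic from \<open>u\<close> to \<open>y\<close> passes through \<open>x\<close>, so its first step leads
  towards \<open>x\<close>. A neighbour \<open>v\<close> with skew \<open>2 - D\<close> would be another step towards \<open>y\<close>.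
\<close>

lemma low_edge:
  assumes "adj u v" "skew u = - D" "u \<noteq> x"
  shows "skew v \<le> skew u + 1"
proof (rule ccontr)
  assume "\<not> ?thesis"
  then have jump: "skew v = skew u + 2" using skew_edge[OF assms(1)] by linarith
  have u: "u \<in> V" by (rule adjD(1)[OF assms(1)])
  obtain w where w: "adj u w" "d u x = Suc (d w x)" using towards[OF u x assms(3)] by blast
  have "d w y \<le> d w x + d x y" by (rule triangle[OF adjD(2)[OF w(1)] x y])
  moreover have "d u y = d u x + d x y" using assms(2) unfolding skew_def by linarith
  ultimately have uy: "d u y = Suc (d w y)" using w dist_edge[OF w(1) y] by linarith
  have "w = v" by (rule towards_unique[OF w(1) assms(1) y uy skew_step2(2)[OF assms(1) jump]])
  then have "d u x = Suc (d v x)" using w(2) by simp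
  then show False using skew_step2(1)[OF assms(1) jump] by linarith
qed

lemma dist_across:
  assumes "a \<in> A" "b \<in> B"
  shows "d b a = d b x + d x a \<or> d b a = d b y + d y a"
  using assms(2)
proof (induction "d b a" arbitrary: b rule: less_induct)
  case less
  have ab: "a \<in> V" "b \<in> V" "b \<noteq> a" using less assms A_V B_V disj by auto
  obtain w where w: "adj b w" "d b a = Suc (d w a)" using towards[OF ab(2,1,3)] by blast
  have one: "d b w \<le> 1" using dist_edge[OF w(1), of w] w adjD by simp
  consider "w \<in> B" | "w = x" | "w = y" using nbr_B less w by blast
  then show ?case
  proof cases
    case 1
    then have "d w a = d w x + d x a \<or> d w a = d w y + d y a" using less w by simp
    then show ?thesis
      using triangle[of b x a] triangle[of b y a] dist_edge[OF w(1) x] dist_edge[OF w(1) y] ab w x y by fastforce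
  next
    case 2
    then show ?thesis using triangle[of b x a] one w ab x by simp
  next
    case 3
    then show ?thesis using triangle[of b y a] one w ab y by simp
  qed
qed

text \<open>
  The hypothesis makes the routes through \<open>x\<close> and through \<open>y\<close> equally long, so both are shortest.
  The steps of \<open>b\<close> towards \<open>x\<close> and towards \<open>y\<close> are then both steps towards \<open>a\<close>, hence equal, and
  such a step keeps the skew. Moving \<open>b\<close> in this way leads to \<open>x\<close> or to \<open>y\<close>, where the skew is
  known.
\<close>

lemma opposite_values:
  assumes "a \<in> A" "b \<in> B" "skew a + skew b = 0"
  shows "\<bar>skew b\<bar> = D"
  using assms(2,3)
proof (induction "d b a" arbitrary: b rule: less_induct)
  case less
  have ab: "a \<in> V" "b \<in> V" "b \<noteq> x" "b \<noteq> y" using less assms A_V B_V disj by auto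
  have sym: "d x a = d a x" "d y a = d a y"
    by (rule dist_sym[OF x ab(1)], rule dist_sym[OF y ab(1)])
  have "d b x + d a x = d b y + d a y" using less(3) unfolding skew_def by linarith
  then have via: "d b a = d b x + d a x" "d b a = d b y + d a y"
    using dist_across[OF assms(1) less(2)] sym by linarith+
  obtain w where w: "adj b w" "d b x = Suc (d w x)" using towards[OF ab(2) x ab(3)] by blast
  obtain w' where w': "adj b w'" "d b y = Suc (d w' y)" using towards[OF ab(2) y ab(4)] by blast
  have wa: "d b a = Suc (d w a)"
    using triangle[OF adjD(2)[OF w(1)] x ab(1)] dist_edge[OF w(1) ab(1)] w(2) via(1) sym(1) by linarith
  have wa': "d b a = Suc (d w' a)"
    using triangle[OF adjD(2)[OF w'(1)] y ab(1)] dist_edge[OF w'(1) ab(1)] w'(2) via(2) sym(2) by linarith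
  have "w = w'" using towards_unique[OF w(1) w'(1) ab(1) wa wa'] .
  then have same: "skew w = skew b" using w w' unfolding skew_def by simp
  show ?case
  proof (cases "w \<in> B")
    case True
    have "d w a < d b a" "skew a + skew w = 0" using wa less(3) same by simp_all
    from less(1)[OF this(1) True this(2)] show ?thesis using same by simp
  next
    case False
    then show ?thesis using nbr_B[OF less(2) w(1)] same skew_x skew_y by auto
  qed
qed

text \<open>
  A discrete intermediate value theorem. On the way from \<open>x\<close> to \<open>y\<close> inside \<open>A\<close>, the skew climbs from
  \<open>- D\<close> to \<open>D\<close> in steps of at most 2, so it can only jump over \<open>t + 1\<close> by going from \<open>t\<close> to
  \<open>t + 2\<close>. For \<open>t > - D\<close> this is impossible if \<open>A\<close> omits \<open>t\<close>. For \<open>t = - D\<close> the jump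
  is impossible from a vertex of \<open>A\<close> by \<open>low_edge\<close>, and from \<open>x\<close> if the geodesic from \<open>x\<close> to \<open>y\<close>
  does not start into \<open>A\<close>.
\<close>

lemma value_attained:
  assumes "- D \<le> t" "t \<le> D - 2"
    and gap: "if t = - D then \<forall>u\<in>A. adj x u \<longrightarrow> d x y \<noteq> Suc (d u y) else t \<notin> skew ` A"
  shows "t + 1 \<in> skew ` A"
proof (cases "\<exists>a\<in>A. skew a \<le> t")
  case True
  \<comment> \<open>The lower part of \<open>A\<close> must be left by an edge avoiding \<open>x\<close>, hence upwards.\<close>
  let ?C = "{a\<in>A. skew a \<le> t}"
  have "y \<in> V - {x}" "y \<notin> ?C" using y x_neq_y disj by auto
  then obtain u v where uv: "u \<in> ?C" "v \<in> V - {x} - ?C" "adj u v"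
    using no_cut_vertex[OF two_connected x, of ?C] True A_V disj by blast
  have v: "v \<in> A \<or> v = y" using uv nbr_A by blast
  have "skew v > t" using v uv skew_y assms by auto
  moreover have "skew v \<le> t + 1"
  proof (cases "skew u = t")
    case True
    then have "t = - D" using gap uv by (auto split: if_splits)
    then show ?thesis using low_edge[OF uv(3)] True uv disj by force
  next
    case False
    then show ?thesis using skew_edge[OF uv(3)] uv by simp
  qed
  ultimately have fv: "skew v = t + 1" by simp
  then have "v \<noteq> y" using skew_y assms(2) by auto
  with v have "v \<in> A" by blast
  then show ?thesis using imageI[of v A skew] fv by simp
next
  case False
  \<comment> \<open>Now all of \<open>A\<close> lies above \<open>t\<close>, so the climb over \<open>t\<close> is the edge from \<open>x\<close> into \<open>A\<close>.\<close>
  have "A \<subseteq> V - {y}" "x \<in> V - {y} - A" using x x_neq_y A_V disj by auto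
  then obtain u v where uv: "u \<in> A" "v \<in> V - {y} - A" "adj u v"
    using no_cut_vertex[OF two_connected y, of A] nonempty by blast
  then have xu: "adj x u" using nbr_A adjacent_commute[of G] by blast
  have "skew u \<le> t + 1"
  proof (cases "t = - D")
    case True
    then have "skew u \<noteq> skew x + 2" using gap skew_step2(2)[OF xu] uv(1) xu by auto
    then show ?thesis using skew_edge[OF xu] skew_x True by simp
  next
    case False
    then show ?thesis using skew_edge[OF xu] skew_x assms by simp
  qed
  moreover have "\<not> skew u \<le> t" using False uv(1) by blast
  ultimately have "skew u = t + 1" by linarith
  then show ?thesis using imageI[OF uv(1), of skew] by simp
qed

lemma avoids_opposite:
  assumes "t \<in> skew ` A" "\<bar>t\<bar> \<noteq> D" "b \<in> B"
  shows "skew b \<noteq> - t"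
proof
  assume "skew b = - t"
  moreover obtain a where "a \<in> A" "skew a = t" using assms(1) by blast
  ultimately show False using opposite_values[of a b] assms(2,3) by simp
qed

lemma swap: "separating_pair G x y B A"
proof unfold_locales
  show "V = {x, y} \<union> B \<union> A" using V_eq by blast
  show "B \<inter> A = {}" using disj by blast
  show "\<not> adj b a" if "b \<in> B" "a \<in> A" for a b
    using separated[OF that(2,1)] adjacent_commute[of G a b] by simp
qed (fact x y x_neq_y disj nonempty two_connected)+

text \<open>
  If \<open>x\<close> and \<open>y\<close> were adjacent, their geodesic would meet neither side, and the skew would have to
  take the value 0 between \<open>-1\<close> and \<open>1\<close> on both sides. But 0 is opposite to itself.
\<close>

lemma not_adjacent: "D \<noteq> 1"
proof
  assume D: "D = 1"
  interpret other: separating_pair G x y B A by (rule swap)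
  have no: "d x y \<noteq> Suc (d u y)" if "u \<in> A \<union> B" for u
    using that D dist_eq_0[of u y] A_V B_V y disj by auto
  have "0 \<in> skew ` A"
    using value_attained[of "-1"] D no by simp
  moreover have "0 \<in> skew ` B"
    using other.value_attained[of "-1"] D no by simp
  then obtain b where "b \<in> B" "skew b = 0" by force
  ultimately show False using avoids_opposite[of 0 b] D by simp
qed

text \<open>
  The first inner vertex \<open>p\<close> of the geodesic from \<open>x\<close> to \<open>y\<close> can have no neighbours off this
  geodesic: the two levels of skew next to its own are empty in \<open>B\<close>, and its own level can contain
  nothing else, since the rest of it would be attached to the graph through \<open>p\<close> only.
\<close>

lemma geodesic_neighbour_degree:
  assumes "p \<in> B" "adj x p" "d x y = Suc (d p y)"
  shows "\<exists>u v. {w \<in> V. adj p w} \<subseteq> {u, v}"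
proof -
  have D2: "D \<ge> 2" using D_pos not_adjacent by linarith
  have px: "d p x = 1"
  proof -
    have "d p x \<noteq> 0" using dist_eq_0[OF B_V[OF assms(1)] x] assms(1) disj by blast
    then show ?thesis using dist_edge'(1)[OF assms(2) x] x by simp
  qed
  then have skew_p: "skew p = 2 - D" using assms unfolding skew_def by simp
  have p_unique: "u = p" if "adj x u" "d x y = Suc (d u y)" for u
    using towards_unique[OF that(1) assms(2) y that(2) assms(3)] .
  obtain q where q: "adj p q" "d p y = Suc (d q y)"
    using towards[of p y] assms(1) B_V y disj by blast
  have q_unique: "w = q" if "adj p w" "d p y = Suc (d w y)" for w
    using towards_unique[OF that(1) q(1) y that(2) q(2)] .
  have "d q x = 2"
  proof -
    have qV: "q \<in> V" using adjD[OF q(1)] by blast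
    have "d x y \<le> d q x + d q y" using triangle[OF x qV y] dist_sym[OF x qV] by simp
    then show ?thesis using dist_edge'(1)[OF q(1) x] px q(2) assms(3) by simp
  qed
  then have skew_q: "skew q = 4 - D" using q assms unfolding skew_def by simp
  have "D - 2 \<notin> skew ` A"
  proof
    assume "D - 2 \<in> skew ` A"
    then obtain a where "a \<in> A" "skew a = D - 2" by force
    then show False using opposite_values[OF _ assms(1)] skew_p D2 by force
  qed
  then have D1: "D - 1 \<in> skew ` A"
    using value_attained[of "D - 2"] D2 by auto
  \<comment> \<open>For \<open>D = 2\<close> the value \<open>D - 4\<close> is \<open>- D\<close>, and \<open>q\<close> is \<open>y\<close> instead of a vertex of \<open>B\<close>.\<close>
  have D3: "D - 3 \<in> skew ` A"
  proof (cases "D = 2")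
    case True
    have "\<forall>u\<in>A. adj x u \<longrightarrow> d x y \<noteq> Suc (d u y)" using p_unique assms(1) disj by blast
    then show ?thesis using value_attained[of "D - 4"] True by simp
  next
    case False
    then have "q \<in> B" using nbr_B[OF assms(1) q(1)] skew_q skew_x skew_y by auto
    then have "D - 4 \<notin> skew ` A"
    proof (intro notI)
      assume "D - 4 \<in> skew ` A"
      then obtain a where "a \<in> A" "skew a = D - 4" by force
      then show False using opposite_values[OF _ \<open>q \<in> B\<close>] skew_q False D2 by force
    qed
    then show ?thesis using value_attained[of "D - 4"] D2 False by auto
  qed
  have avoid: "skew b \<noteq> 1 - D" "skew b \<noteq> 3 - D" if "b \<in> B" for b
    using avoids_opposite[OF D1 _ that] avoids_opposite[OF D3 _ that] D2 by auto
  have nbr: "w \<in> B \<and> skew w = 2 - D \<or> skew w = skew v + 2 \<or> skew w = skew v - 2"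
    if v: "v \<in> B" "skew v = 2 - D" and vw: "adj v w" for v w
  proof -
    have "skew w \<noteq> 1 - D \<and> skew w \<noteq> 3 - D"
    proof (cases "w \<in> B")
      case True
      then show ?thesis using avoid by blast
    next
      case False
      then have "skew w = D \<or> skew w = - D" using nbr_B[OF v(1) vw] skew_x skew_y by blast
      then show ?thesis using D2 by presburger
    qed
    moreover have "w \<in> B" if "skew w = 2 - D" using nbr_B[OF v(1) vw] that skew_x skew_y D2 by auto
    moreover have "adj w v" using vw adjacent_commute[of G] by simp
    ultimately show ?thesis using skew_edge[OF vw] skew_edge[of w v] v by force
  qed
  \<comment> \<open>For \<open>v \<noteq> p\<close> in the level of \<open>p\<close>, the step towards \<open>x\<close> stays in the level: a step down would end
    in \<open>x\<close> by \<open>low_edge\<close>, making \<open>v\<close> the first vertex \<open>p\<close> of the geodesic. This step is then also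
    the step towards \<open>y\<close>, so that no edge from \<open>v\<close> is left for changing the skew by 2.\<close>
  let ?S = "{v\<in>B. skew v = 2 - D}"
  have closed: "w \<in> ?S" if v: "v \<in> ?S" "v \<noteq> p" and vw: "adj v w" for v w
  proof -
    have vV: "v \<in> V" "v \<noteq> x" using v B_V disj by auto
    obtain u where u: "adj v u" "d v x = Suc (d u x)" using towards vV x by metis
    have "skew u \<noteq> skew v + 2" using skew_step2[OF u(1)] u by auto
    moreover have "skew u \<noteq> skew v - 2"
    proof
      assume fu: "skew u = skew v - 2"
      have uv: "adj u v" using u adjacent_commute[of G] by simp
      have "u = x" using low_edge[OF uv] fu v by force
      then show False using p_unique[of v] skew_step2[OF uv] fu v uv by simp
    qed
    ultimately have fu: "skew u = skew v" using nbr[OF _ _ u(1)] v by auto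
    then have uy: "d v y = Suc (d u y)" using u unfolding skew_def by simp
    have "skew w \<noteq> skew v + 2"
    proof
      assume fw: "skew w = skew v + 2"
      then have "w = u" using towards_unique[OF vw u(1) y _ uy] skew_step2[OF vw] by simp
      then show False using fu fw by simp
    qed
    moreover have "skew w \<noteq> skew v - 2"
    proof
      assume fw: "skew w = skew v - 2"
      have "adj w v" using vw adjacent_commute[of G] by simp
      then have "w = u" using towards_unique[OF vw u(1) x _ u(2)] skew_step2[of w v] fw by simp
      then show False using fu fw by simp
    qed
    ultimately show ?thesis using nbr[OF _ _ vw] v by auto
  qed
  have S: "?S = {p}"
  proof (rule ccontr)
    assume "?S \<noteq> {p}"
    then have "?S - {p} \<noteq> {}" using assms(1) skew_p by blast
    moreover have "x \<in> V - {p}" "x \<notin> ?S" using x assms disj by auto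
    ultimately obtain u v where "u \<in> ?S - {p}" "v \<in> V - {p} - (?S - {p})" "adj u v"
      using no_cut_vertex[OF two_connected, of p "?S - {p}"] B_V assms(1) by blast
    then show False using closed[of u v] by blast
  qed
  have "w = x \<or> w = q" if pw: "adj p w" for w
  proof -
    have "skew w \<noteq> skew p - 2 \<or> w = x"
    proof (rule ccontr)
      assume w: "\<not> ?thesis"
      then have "d p x = Suc (d w x)" using skew_step2[of w p] pw adjacent_commute[of G] by simp
      then show False using px w dist_eq_0[of w x] adjD[OF pw] x by simp
    qed
    moreover have "skew w = skew p + 2 \<Longrightarrow> w = q" using q_unique[OF pw] skew_step2[OF pw] by simp
    moreover have "w \<noteq> p" using adjD[OF pw] by simp
    ultimately show ?thesis using nbr[OF assms(1) skew_p pw] S by blast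
  qed
  then show ?thesis by blast
qed

lemma small_degree_vertex: "\<exists>p\<in>V. \<exists>u v. {w \<in> V. adj p w} \<subseteq> {u, v}"
proof -
  interpret other: separating_pair G x y B A by (rule swap)
  obtain p where p: "adj x p" "d x y = Suc (d p y)" using towards[OF x y x_neq_y] by blast
  have "p \<noteq> x" using adjD[OF p(1)] by simp
  moreover have "p \<noteq> y" using p(2) not_adjacent y by auto
  ultimately have "p \<in> A \<union> B" using adjD[OF p(1)] V_eq by auto
  then show ?thesis
    using geodesic_neighbour_degree[OF _ p] other.geodesic_neighbour_degree[OF _ p] adjD[OF p(1)] by blast
qed

end


section \<open>Minimum degree three forces 3-connectivity\<close>

lemma min_degree_ge_imp_degree_ge:
  assumes "min_degree G \<ge> k" "v \<in> verts G"
  shows "degree G v \<ge> k"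
  using assms unfolding min_degree_def by (meson INF_lower order_trans)

text \<open>
  One side is the component of a vertex, the other side is the union of all other components.
\<close>

lemma vertex_cut_splits:
  assumes "simple_graph G" "S \<subseteq> verts G" "\<not> connected_graph (remove_verts G S)"
  obtains A B where "verts G = S \<union> A \<union> B" "A \<inter> S = {}" "B \<inter> S = {}" "A \<inter> B = {}" "A \<noteq> {}" "B \<noteq> {}"
    "\<And>a b. a \<in> A \<Longrightarrow> b \<in> B \<Longrightarrow> \<not> adjacent G a b"
proof -
  let ?H = "remove_verts G S"
  obtain a b where ab: "a \<in> verts ?H" "b \<in> verts ?H" "\<nexists>p. path_between ?H a p b"
    using assms unfolding connected_graph_def by blast
  define A where "A = {v. \<exists>p. path_between ?H v p b}"
  have sub: "A \<subseteq> verts ?H"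
    by (force simp: A_def path_between_def)
  have "path_between ?H b [b] b" using ab by (simp add: path_between_def)
  then have bA: "b \<in> A" unfolding A_def by blast
  have "v \<in> A" if "u \<in> A" "v \<in> verts ?H" "adjacent G u v" for u v
  proof -
    have "adjacent ?H v u"
      using that sub by (auto simp: remove_verts_def adjacent_def insert_commute)
    with that show ?thesis unfolding A_def by (blast elim: path_between_extend)
  qed
  then have "\<not> adjacent G u v" if "u \<in> A" "v \<in> verts ?H - A" for u v
    using that by blast
  moreover have "a \<in> verts ?H - A" using ab by (simp add: A_def)
  moreover have V: "verts ?H = verts G - S" by (simp add: remove_verts_def)
  moreover have "verts G = S \<union> A \<union> (verts ?H - A)" "A \<inter> S = {}"
    using sub assms(2) unfolding V by blast+
  ultimately show ?thesis
    using that[of A "verts ?H - A"] bA by blast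
qed

lemma geodetic_3_connected:
  assumes G: "simple_graph G" "k_connected 2 G" "geodetic G" "min_degree G \<ge> 3"
  shows "k_connected 3 G"
proof -
  have deg: "\<not> {w \<in> verts G. adjacent G v w} \<subseteq> {a, b}" if "v \<in> verts G" for v a b
  proof
    assume sub: "{w \<in> verts G. adjacent G v w} \<subseteq> {a, b}"
    have "card {w \<in> verts G. adjacent G v w} \<le> card {a, b}" using sub by (intro card_mono) auto
    also have "\<dots> \<le> 2" by (simp add: card_insert_if)
    finally have "degree G v \<le> 2"
      using sub finite_subset[OF sub] by (simp add: degree_def ecard_def adjacent_commute[of G _ v] numeral_eq_enat)
    moreover have "degree G v \<ge> 3" using min_degree_ge_imp_degree_ge[OF G(4) that] .
    ultimately have "(3 :: enat) \<le> 2" by (rule order_trans[rotated])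
    then show False by simp
  qed
  have "ecard (verts G) > enat 3"
  proof (rule ccontr)
    assume "\<not> ?thesis"
    then have fin: "finite (verts G)" "card (verts G) \<le> 3" by (auto simp: ecard_def split: if_splits)
    have "card (verts G) > 2" using G(2) fin by (simp add: k_connected_def ecard_def)
    with fin have "card (verts G) = 3" by simp
    then obtain u v w where "verts G = {u, v, w}" by (auto simp: card_3_iff)
    then show False using deg[of u v w] simple_graph_adjacentD(3)[OF G(1), of u] by auto
  qed
  moreover have "connected_graph (remove_verts G S)" if S: "S \<subseteq> verts G" "ecard S < enat 3" for S
  proof (rule ccontr)
    assume no: "\<not> ?thesis"
    have fin: "finite S" "card S < 3" using S by (auto simp: ecard_def split: if_splits)
    have "\<not> card S < 2" using no S fin G(2) by (auto simp: k_connected_def ecard_def)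
    with fin have "card S = 2" by simp
    then obtain x y where xy: "S = {x, y}" "x \<noteq> y" by (auto simp: card_2_iff)
    obtain A B where AB: "verts G = S \<union> A \<union> B" "A \<inter> S = {}" "B \<inter> S = {}" "A \<inter> B = {}" "A \<noteq> {}" "B \<noteq> {}"
      "\<And>a b. a \<in> A \<Longrightarrow> b \<in> B \<Longrightarrow> \<not> adjacent G a b"
      using vertex_cut_splits[OF G(1) S(1) no] by blast
    interpret separating_pair G x y A B
      using G AB xy by unfold_locales auto
    show False using small_degree_vertex deg by blast
  qed
  ultimately show ?thesis unfolding k_connected_def by blast
qed


section \<open>The Petersen graph\<close>

text \<open>
  A local description of the Moore graphs of diameter 2 and girth 5; stars and infinite graphs can
  satisfy it too.
\<close>

locale moore_diameter_two =
  fixes G :: "'a ugraph"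
  assumes simple: "simple_graph G"
    and triangle_free: "adjacent G u v \<Longrightarrow> adjacent G u w \<Longrightarrow> \<not> adjacent G v w"
    and common_neighbour:
      "u \<in> verts G \<Longrightarrow> v \<in> verts G \<Longrightarrow> u \<noteq> v \<Longrightarrow> \<not> adjacent G u v
        \<Longrightarrow> \<exists>!w. adjacent G u w \<and> adjacent G w v"
begin

lemma geodetic: "geodetic G"
  unfolding geodetic_def
proof (intro ballI)
  fix u v assume uv: "u \<in> verts G" "v \<in> verts G"
  note adjD = simple_graph_adjacentD[OF simple]
  have cases: "(p = [u] \<and> u = v) \<or> (p = [u, v] \<and> adjacent G u v) \<or>
      (\<exists>w. p = [u, w, v] \<and> u \<noteq> v \<and> adjacent G u w \<and> adjacent G w v) \<or> length p > 3 \<and> u \<noteq> v"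
    if "path_between G u p v" for p
  proof -
    consider "p = []" | a where "p = [a]" | a b where "p = [a, b]" | a b c where "p = [a, b, c]"
      | a b c e r where "p = a # b # c # e # r"
      by (metis list.exhaust)
    then show ?thesis
    proof cases
      case (5 a b c e r)
      then have "a \<noteq> last (e # r)" "a = u" "last (e # r) = v"
        using that last_in_set[of "e # r"] by (auto simp: path_between_def)
      with 5 show ?thesis by simp
    qed (use that in \<open>auto simp: path_between_def\<close>)
  qed
  consider "u = v" | "adjacent G u v" | "u \<noteq> v" "\<not> adjacent G u v" by blast
  then show "\<exists>!p. shortest_path G u p v"
  proof cases
    case 1
    then have "path_between G u [u] v" using uv by (simp add: path_between_def)
    then show ?thesis
    proof (rule unique_shortest_pathI)
      show "length [u] < length q" if "path_between G u q v" "q \<noteq> [u]" for q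
        using cases[OF that(1)] 1 that(2) by auto
    qed
  next
    case 2
    then have "path_between G u [u, v] v" using uv adjD[OF 2] by (simp add: path_between_def)
    then show ?thesis
    proof (rule unique_shortest_pathI)
      show "length [u, v] < length q" if "path_between G u q v" "q \<noteq> [u, v]" for q
        using cases[OF that(1)] adjD[OF 2] that(2) by auto
    qed
  next
    case 3
    then obtain w where w: "adjacent G u w" "adjacent G w v"
      and w_unique: "\<And>w'. adjacent G u w' \<Longrightarrow> adjacent G w' v \<Longrightarrow> w' = w"
      using common_neighbour[OF uv] by metis
    have "path_between G u [u, w, v] v"
      using uv 3 w adjD[OF w(1)] adjD[OF w(2)] by (simp add: path_between_def)
    then show ?thesis
    proof (rule unique_shortest_pathI)
      show "length [u, w, v] < length q" if "path_between G u q v" "q \<noteq> [u, w, v]" for q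
      proof -
        have "q \<noteq> [u, w', v]" if "adjacent G u w'" "adjacent G w' v" for w'
          using w_unique[OF that] \<open>q \<noteq> [u, w, v]\<close> by blast
        then have "length q > 3" using cases[OF that(1)] 3 by blast
        then show ?thesis by simp
      qed
    qed
  qed
qed

text \<open>
  If the only common neighbour \<open>w\<close> of \<open>u\<close> and \<open>v\<close> is removed, one can start with another neighbour
  \<open>t\<close> of \<open>u\<close>: the common neighbour of \<open>t\<close> and \<open>v\<close> is not \<open>w\<close>, since \<open>u\<close>, \<open>t\<close>, \<open>w\<close> is no
  triangle. So \<open>u\<close> and \<open>v\<close> lie on a 5-cycle.
\<close>

lemma two_connected:
  assumes "min_degree G \<ge> 2" "ecard (verts G) > 2"
  shows "k_connected 2 G"
  unfolding k_connected_def
proof (intro conjI allI impI)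
  show "enat 2 < ecard (verts G)" using assms(2) by (simp add: numeral_eq_enat)
  fix S assume S: "S \<subseteq> verts G \<and> ecard S < enat 2"
  then have fin: "finite S" "card S \<le> Suc 0" by (auto simp: ecard_def split: if_splits)
  let ?H = "remove_verts G S"
  note adjD = simple_graph_adjacentD[OF simple]
  have adj_H: "adjacent ?H a b" if "adjacent G a b" "a \<notin> S" "b \<notin> S" for a b
    using that by (simp add: remove_verts_def adjacent_def)
  have V_H: "a \<in> verts ?H \<longleftrightarrow> a \<in> verts G \<and> a \<notin> S" for a
    by (simp add: remove_verts_def)
  show "connected_graph ?H"
    unfolding connected_graph_def
  proof (intro ballI)
    fix u v assume "u \<in> verts ?H" "v \<in> verts ?H"
    then have uv: "u \<in> verts G" "v \<in> verts G" "u \<notin> S" "v \<notin> S" by (auto simp: V_H)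
    consider "u = v" | "adjacent G u v" | "u \<noteq> v" "\<not> adjacent G u v" by blast
    then show "\<exists>p. path_between ?H u p v"
    proof cases
      case 1
      then have "path_between ?H u [u] v" using uv by (simp add: path_between_def V_H)
      then show ?thesis by blast
    next
      case 2
      then have "path_between ?H u [u, v] v"
        using uv adj_H adjD[OF 2] by (simp add: path_between_def V_H)
      then show ?thesis by blast
    next
      case 3
      then obtain w where w: "adjacent G u w" "adjacent G w v"
        using common_neighbour[OF uv(1,2)] by blast
      show ?thesis
      proof (cases "w \<in> S")
        case False
        then have "path_between ?H u [u, w, v] v"
          using uv 3 adj_H w adjD[OF w(1)] adjD[OF w(2)] by (simp add: path_between_def V_H)
        then show ?thesis by blast
      next
        case True
        then have S_eq: "S = {w}" using fin by (auto simp: card_le_Suc0_iff_eq)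
        have "\<not> {t \<in> verts G. adjacent G u t} \<subseteq> {w}"
        proof
          assume sub: "{t \<in> verts G. adjacent G u t} \<subseteq> {w}"
          have "degree G u \<le> 1"
            using card_mono[OF _ sub] finite_subset[OF sub]
            by (simp add: degree_def ecard_def one_enat_def)
          then have "(2 :: enat) \<le> 1"
            using min_degree_ge_imp_degree_ge[OF assms(1) uv(1)] by (rule order_trans[rotated])
          then show False by (simp add: one_enat_def numeral_eq_enat)
        qed
        then obtain t where t: "adjacent G u t" "t \<noteq> w" by blast
        have tv: "t \<noteq> v" "\<not> adjacent G t v"
          using t 3 w common_neighbour[OF uv(1,2)] by blast+
        then obtain c where c: "adjacent G t c" "adjacent G c v"
          using common_neighbour[of t v] uv adjD[OF t(1)] by blast
        have "c \<noteq> w" using triangle_free[OF t(1) w(1)] c by blast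
        moreover have "c \<noteq> u" using 3 c by blast
        ultimately have "path_between ?H u [u, t, c, v] v"
          using uv 3 adj_H t tv c adjD[OF t(1)] adjD[OF c(1)] adjD[OF c(2)]
          unfolding S_eq by (simp add: path_between_def remove_verts_def)
        then show ?thesis by blast
      qed
    qed
  qed
qed

end

lemma not_k_connected_if_small_degree:
  assumes "simple_graph G" "u \<in> verts G" "v \<in> verts G" "u \<noteq> v" "\<not> adjacent G u v" "degree G u < enat k"
  shows "\<not> k_connected k G"
proof
  let ?N = "{w \<in> verts G. adjacent G u w}"
  let ?H = "remove_verts G ?N"
  assume "k_connected k G"
  then have "connected_graph ?H"
    using assms unfolding k_connected_def degree_def by (auto simp: adjacent_commute)
  moreover have "{u} \<subseteq> verts ?H" "v \<in> verts ?H"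
    using assms(2,3,5) simple_graph_adjacentD(3)[OF assms(1), of u u]
    unfolding remove_verts_def ugraph.select_convs by blast+
  moreover from this have "{u} \<noteq> verts ?H" using assms(4) by (metis singletonD)
  ultimately have "\<exists>w\<in>verts ?H. adjacent ?H u w"
    using connected_graph_crossing_edge[of ?H "{u}"] by simp blast
  then show False by (auto simp: remove_verts_def adjacent_def)
qed

lemma verts_petersen: "A \<in> verts petersen \<longleftrightarrow> A \<subseteq> {0..<5} \<and> card A = 2"
  by (simp add: petersen_def Let_def)

lemma adjacent_petersen:
  "adjacent petersen A B \<longleftrightarrow> A \<in> verts petersen \<and> B \<in> verts petersen \<and> A \<inter> B = {}"
  by (auto simp: petersen_def Let_def adjacent_def doubleton_eq_iff)

lemma disjoint_pair_petersen:
  assumes "X \<subseteq> {0..<5}" "card X = 3"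
  shows "A \<in> verts petersen \<and> A \<inter> X = {} \<longleftrightarrow> A = {0..<5} - X"
proof -
  have "finite X" using assms(1) finite_subset by blast
  then have "card ({0..<5} - X) = 2" using assms by (simp add: card_Diff_subset)
  moreover have "A = {0..<5} - X" if "A \<subseteq> {0..<5}" "card A = 2" "A \<inter> X = {}"
    using that calculation by (intro card_subset_eq) auto
  ultimately show ?thesis by (auto simp: verts_petersen)
qed

lemma card_Un_pairs:
  assumes "card A = 2" "card B = 2" "A \<noteq> B" "A \<inter> B \<noteq> {}"
  shows "card (A \<union> B) = 3"
proof -
  have fin: "finite A" "finite B" using assms by (auto intro: card_ge_0_finite)
  have "card (A \<inter> B) \<noteq> 2"
    using assms fin card_subset_eq[of A "A \<inter> B"] card_subset_eq[of B "A \<inter> B"] by auto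
  moreover have "card (A \<inter> B) \<le> 2" "card (A \<inter> B) > 0"
    using assms fin card_mono[of A "A \<inter> B"] by (auto simp: card_gt_0_iff)
  ultimately show ?thesis using card_Un_Int[OF fin] assms by simp
qed

text \<open>
  Three pairwise disjoint pairs do not fit into five elements. Two different intersecting pairs cover
  three elements, and the remaining two elements form their only common neighbour.
\<close>

interpretation petersen: moore_diameter_two petersen
proof
  show "simple_graph petersen"
    unfolding simple_graph_def
  proof
    fix e assume "e \<in> edges petersen"
    then obtain A B where "e = {A, B}" "A \<in> verts petersen" "B \<in> verts petersen" "A \<inter> B = {}"
      by (auto simp: petersen_def Let_def)
    moreover from this have "A \<noteq> B" by (auto simp: verts_petersen)
    ultimately show "e \<subseteq> verts petersen \<and> card e = 2" by simp
  qed
next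
  fix A B C assume "adjacent petersen A B" "adjacent petersen A C"
  then have AB: "A \<subseteq> {0..<5}" "B \<subseteq> {0..<5}" "C \<subseteq> {0..<5}" "card A = 2" "card B = 2" "card C = 2"
    "A \<inter> B = {}" "A \<inter> C = {}"
    by (auto simp: adjacent_petersen verts_petersen)
  show "\<not> adjacent petersen B C"
  proof
    assume "adjacent petersen B C"
    then have "B \<inter> C = {}" by (simp add: adjacent_petersen)
    moreover have "finite A" "finite B" "finite C" using AB by (auto intro: card_ge_0_finite)
    ultimately have "card (A \<union> B \<union> C) = 6"
      using AB by (simp add: card_Un_disjoint Int_Un_distrib2)
    moreover have "card (A \<union> B \<union> C) \<le> card {0..<5::nat}" using AB by (intro card_mono) auto
    ultimately show False by simp
  qed
next
  fix A B assume AB: "A \<in> verts petersen" "B \<in> verts petersen" "A \<noteq> B" "\<not> adjacent petersen A B"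
  then have "card (A \<union> B) = 3" "A \<union> B \<subseteq> {0..<5}"
    using card_Un_pairs[of A B] by (auto simp: verts_petersen adjacent_petersen)
  from disjoint_pair_petersen[OF this(2,1)]
  have "adjacent petersen A C \<and> adjacent petersen C B \<longleftrightarrow> C = {0..<5} - (A \<union> B)" for C
    using AB(1,2) by (auto simp: adjacent_petersen)
  then show "\<exists>!C. adjacent petersen A C \<and> adjacent petersen C B" by simp
qed

lemma degree_petersen:
  assumes "A \<in> verts petersen"
  shows "degree petersen A = 3"
proof -
  have A: "A \<subseteq> {0..<5}" "card A = 2" using assms by (auto simp: verts_petersen)
  have nbrs: "{B \<in> verts petersen. adjacent petersen A B} = {B. B \<subseteq> {0..<5} - A \<and> card B = 2}"
    using A unfolding adjacent_petersen verts_petersen by blast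
  have "card ({0..<5} - A) = 3" using A finite_subset[OF A(1)] by (simp add: card_Diff_subset)
  then have "card {B. B \<subseteq> {0..<5} - A \<and> card B = 2} = 3"
    by (simp add: n_subsets choose_two)
  then show ?thesis
    unfolding degree_def nbrs ecard_def by (simp add: numeral_eq_enat)
qed

lemma ecard_verts_petersen: "ecard (verts petersen) = 10"
proof -
  have "verts petersen = {A. A \<subseteq> {0..<5} \<and> card A = 2}" using verts_petersen by blast
  then show ?thesis by (simp add: ecard_def n_subsets choose_two numeral_eq_enat)
qed

theorem theorem1p1:
  shows "(\<forall>G :: 'a ugraph.
            simple_graph G \<and> k_connected 2 G \<and> geodetic G \<and> min_degree G \<ge> 3
              \<longrightarrow> k_connected 3 G)
       \<and> (simple_graph petersen \<and> k_connected 2 petersen \<and> geodetic petersen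
            \<and> min_degree petersen \<ge> 3 \<and> \<not> k_connected 4 petersen)"
proof (intro conjI allI impI)
  show "k_connected 3 G"
    if "simple_graph G \<and> k_connected 2 G \<and> geodetic G \<and> min_degree G \<ge> 3" for G :: "'a ugraph"
    using that geodetic_3_connected by blast
  show min_degree: "min_degree petersen \<ge> 3"
    unfolding min_degree_def by (intro INF_greatest) (simp add: degree_petersen)
  show "simple_graph petersen" by (rule petersen.simple)
  show "geodetic petersen" by (rule petersen.geodetic)
  have "min_degree petersen \<ge> 2" by (rule order_trans[OF _ min_degree]) simp
  then show "k_connected 2 petersen"
    by (rule petersen.two_connected) (simp add: ecard_verts_petersen)
  show "\<not> k_connected 4 petersen"
  proof (rule not_k_connected_if_small_degree)
    show "{0, 1} \<in> verts petersen" "{0, 2} \<in> verts petersen" by (simp_all add: verts_petersen)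
    then show "degree petersen {0, 1} < enat 4" by (simp add: degree_petersen numeral_eq_enat)
    show "{0, 1} \<noteq> {0, 2 :: nat}" by (simp add: doubleton_eq_iff)
    show "\<not> adjacent petersen {0, 1} {0, 2}" by (simp add: adjacent_petersen)
  qed (rule petersen.simple)
qed

end
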